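(* Let $\mathcal{A}$ be an independence algebra with universe $A$ and let $\mathcal{B}$ be a non-empty subalgebra of $\mathcal{A}$ with universe $B$. Assume $\mathcal{B}\neq\mathcal{A}$ and that either $\dim B\geq 2$, or $\langle\emptyset\rangle\neq\emptyset$ and $\dim B=1$. Let $T(\mathcal{A},\mathcal{B})$ be the semigroup of all endomorphisms of $\mathcal{A}$ whose image is contained in $B$, and let $Q=\{\alpha\in T(\mathcal{A},\mathcal{B}): A\alpha\subseteq B\alpha\}$. If $\alpha,\beta\in T(\mathcal{A},\mathcal{B})$, then $\alpha\,\mathcal{D}\,\beta$ in $T(\mathcal{A},\mathcal{B})$ if and only if $\ker\alpha=\ker\beta$ or ($\rho(\alpha)=\rho(\beta)$ and $\alpha,\beta\in Q$).
   Context: An algebra $\mathcal{A}=\langle A;F\rangle$ has a non-empty universe $A$ and a set $F$ of finitary operations. For $X\subseteq A$, $\langle X\rangle$ is the set of all $t(a_1,\dots,a_n)$ with $t$ a term operation and $a_i\in X$ (the subalgebra generated by $X$); $\langle\emptyset\rangle$ is the set of constants, i.e. values of nullary term operations (possibly empty). $X$ is independent if $x\notin\langle X\setminus\{x\}\rangle$ for all $x\in X$; a basis of a subalgebra is an independent generating set. Exchange property (EP): for all $X\subseteq A$ and $a,b\in A$, if $b\in\langle X\cup\{a\}\rangle$ and $b\notin\langle X\rangle$ then $a\in\langle X\cup\{b\}\rangle$. Under (EP) every subalgebra has a basis, all its bases have the same cardinality (its dimension, $\dim$), and independent sets extend to bases. Free basis property (F): every map from a basis of $\mathcal{A}$ to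 $A$ extends to an endomorphism of $\mathcal{A}$. An independence algebra is an algebra satisfying (EP) and (F). Dimensions may be finite or infinite. Maps are written on the right and composed left to right. $\rho(\alpha)=\dim(A\alpha)$; $\ker\alpha=\{(x,y)\in A\times A: x\alpha=y\alpha\}$. $\mathcal{D}=\mathcal{L}\vee\mathcal{R}=\mathcal{L}\circ\mathcal{R}=\mathcal{R}\circ\mathcal{L}$ is Green's relation. *)

theory Defs
  imports "HOL-Library.FuncSet"
begin

unbundle cardinal_syntax

section \<open>Algebras, term operations and independence\<close>

text \<open>
  An operation is a pair \<open>(k, f)\<close> of an arity \<open>k\<close> and a function \<open>f\<close> of which only the values
  on lists of length \<open>k\<close> over the universe matter.
\<close>

type_synonym 'a operation = "nat \<times> ('a list \<Rightarrow> 'a)"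

definition closed_under :: "'a operation set \<Rightarrow> 'a set \<Rightarrow> bool" where
  "closed_under F S \<longleftrightarrow> (\<forall>(k, f) \<in> F. \<forall>xs. length xs = k \<and> set xs \<subseteq> S \<longrightarrow> f xs \<in> S)"

definition subalgebra :: "'a set \<Rightarrow> 'a operation set \<Rightarrow> 'a set \<Rightarrow> bool" where
  "subalgebra A F B \<longleftrightarrow> B \<subseteq> A \<and> closed_under F B"

inductive term_op :: "'a operation set \<Rightarrow> nat \<Rightarrow> ('a list \<Rightarrow> 'a) \<Rightarrow> bool" for F n where
  proj: "i < n \<Longrightarrow> term_op F n (\<lambda>xs. xs ! i)"
| comp: "(k, f) \<in> F \<Longrightarrow> length ts = k \<Longrightarrow> (\<And>t. t \<in> set ts \<Longrightarrow> term_op F n t)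
    \<Longrightarrow> term_op F n (\<lambda>xs. f (map (\<lambda>t. t xs) ts))"

text \<open>Since \<open>n = 0\<close> is allowed, \<open>gen F {}\<close> is the set of values of the nullary term operations.\<close>

definition gen :: "'a operation set \<Rightarrow> 'a set \<Rightarrow> 'a set" where
  "gen F X = {t xs | t n xs. term_op F n t \<and> length xs = n \<and> set xs \<subseteq> X}"

definition independent :: "'a operation set \<Rightarrow> 'a set \<Rightarrow> bool" where
  "independent F X \<longleftrightarrow> (\<forall>x \<in> X. x \<notin> gen F (X - {x}))"

definition basis :: "'a operation set \<Rightarrow> 'a set \<Rightarrow> 'a set \<Rightarrow> bool" where
  "basis F S X \<longleftrightarrow> X \<subseteq> S \<and> independent F X \<and> gen F X = S"

text \<open>
  The dimension is a possibly infinite cardinal, to be compared up to \<open>=o\<close>; the exchange property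
  makes it independent of the chosen basis.
\<close>

definition adim :: "'a operation set \<Rightarrow> 'a set \<Rightarrow> 'a rel" where
  "adim F S = |SOME X. basis F S X|"

text \<open>
  Endomorphisms are extensional (\<open>undefined\<close> outside the universe), so that equality of
  endomorphisms is equality of maps on \<open>A\<close>.
\<close>

definition endos :: "'a set \<Rightarrow> 'a operation set \<Rightarrow> ('a \<Rightarrow> 'a) set" where
  "endos A F = {\<alpha> \<in> A \<rightarrow>\<^sub>E A. \<forall>(k, f) \<in> F. \<forall>xs. length xs = k \<and> set xs \<subseteq> A
     \<longrightarrow> \<alpha> (f xs) = f (map \<alpha> xs)}"

locale universal_algebra =
  fixes A :: "'a set" and F :: "'a operation set"
  assumes nonempty: "A \<noteq> {}"
    and closed: "closed_under F A"

locale independence_algebra = universal_algebra +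
  assumes exchange: "X \<subseteq> A \<Longrightarrow> a \<in> A \<Longrightarrow> b \<in> A \<Longrightarrow>
      b \<in> gen F (X \<union> {a}) \<Longrightarrow> b \<notin> gen F X \<Longrightarrow> a \<in> gen F (X \<union> {b})"
    and free_basis: "basis F A X \<Longrightarrow> g \<in> X \<rightarrow> A \<Longrightarrow> \<exists>\<alpha> \<in> endos A F. \<forall>x \<in> X. \<alpha> x = g x"


section \<open>Green's relations\<close>

text \<open>
  For a semigroup with carrier \<open>S\<close> and multiplication \<open>m\<close>, the principal one-sided ideals are
  \<open>S\<^sup>1 a\<close> and \<open>a S\<^sup>1\<close>, where the adjoined identity contributes \<open>a\<close> itself.
\<close>

definition left_ideal :: "'s set \<Rightarrow> ('s \<Rightarrow> 's \<Rightarrow> 's) \<Rightarrow> 's \<Rightarrow> 's set" where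
  "left_ideal S m a = insert a {m s a | s. s \<in> S}"

definition right_ideal :: "'s set \<Rightarrow> ('s \<Rightarrow> 's \<Rightarrow> 's) \<Rightarrow> 's \<Rightarrow> 's set" where
  "right_ideal S m a = insert a {m a s | s. s \<in> S}"

definition green_L :: "'s set \<Rightarrow> ('s \<Rightarrow> 's \<Rightarrow> 's) \<Rightarrow> 's rel" where
  "green_L S m = {(a, b) \<in> S \<times> S. left_ideal S m a = left_ideal S m b}"

definition green_R :: "'s set \<Rightarrow> ('s \<Rightarrow> 's \<Rightarrow> 's) \<Rightarrow> 's rel" where
  "green_R S m = {(a, b) \<in> S \<times> S. right_ideal S m a = right_ideal S m b}"

definition green_D :: "'s set \<Rightarrow> ('s \<Rightarrow> 's \<Rightarrow> 's) \<Rightarrow> 's rel" where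
  "green_D S m = green_L S m O green_R S m"

locale semigroup_on =
  fixes S :: "'s set" and m :: "'s \<Rightarrow> 's \<Rightarrow> 's"
  assumes m_closed: "a \<in> S \<Longrightarrow> b \<in> S \<Longrightarrow> m a b \<in> S"
    and m_assoc: "a \<in> S \<Longrightarrow> b \<in> S \<Longrightarrow> c \<in> S \<Longrightarrow> m (m a b) c = m a (m b c)"
begin

lemma green_L_iff:
  "(a, b) \<in> green_L S m \<longleftrightarrow>
     a \<in> S \<and> b \<in> S \<and> a \<in> left_ideal S m b \<and> b \<in> left_ideal S m a"
proof -
  have sub: "left_ideal S m a \<subseteq> left_ideal S m b"
    if "a \<in> S" "b \<in> S" "a \<in> left_ideal S m b" for a b
    using that m_assoc m_closed unfolding left_ideal_def by (auto, metis)
  have self: "a \<in> left_ideal S m a" for a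
    by (simp add: left_ideal_def)
  show ?thesis
    unfolding green_L_def using sub[of a b] sub[of b a] self by blast
qed

lemma green_R_iff:
  "(a, b) \<in> green_R S m \<longleftrightarrow>
     a \<in> S \<and> b \<in> S \<and> a \<in> right_ideal S m b \<and> b \<in> right_ideal S m a"
proof -
  have sub: "right_ideal S m a \<subseteq> right_ideal S m b"
    if ab: "a \<in> S" "b \<in> S" "a \<in> right_ideal S m b" for a b
  proof (cases "a = b")
    case False
    then obtain s where s: "s \<in> S" "a = m b s"
      using ab unfolding right_ideal_def by blast
    have "m a r = m b (m s r)" "m s r \<in> S" if "r \<in> S" for r
      using s that \<open>b \<in> S\<close> by (simp_all add: m_assoc m_closed)
    then show ?thesis
      using s unfolding right_ideal_def by blast
  qed simp
  have self: "a \<in> right_ideal S m a" for a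
    by (simp add: right_ideal_def)
  show ?thesis
    unfolding green_R_def using sub[of a b] sub[of b a] self by blast
qed

lemma equiv_green_L: "equiv S (green_L S m)"
  unfolding equiv_def refl_on_def sym_def trans_def green_L_def by auto

lemma equiv_green_R: "equiv S (green_R S m)"
  unfolding equiv_def refl_on_def sym_def trans_def green_R_def by auto

lemma green_L_right_mult:
  assumes "(a, b) \<in> green_L S m" "t \<in> S"
  shows "(m a t, m b t) \<in> green_L S m"
proof -
  have *: "m x t \<in> left_ideal S m (m y t)"
    if "x \<in> S" "y \<in> S" "x \<in> left_ideal S m y" for x y
    using that assms(2) m_assoc unfolding left_ideal_def by auto
  show ?thesis
    using assms * m_closed unfolding green_L_iff by blast
qed

lemma green_R_left_mult:
  assumes "(a, b) \<in> green_R S m" "t \<in> S"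
  shows "(m t a, m t b) \<in> green_R S m"
proof -
  have *: "m t x \<in> right_ideal S m (m t y)"
    if "x \<in> S" "y \<in> S" "x \<in> right_ideal S m y" for x y
    using that assms(2) m_assoc[symmetric] unfolding right_ideal_def by auto
  show ?thesis
    using assms * m_closed unfolding green_R_iff by blast
qed

lemma LR_subset_RL: "green_L S m O green_R S m \<subseteq> green_R S m O green_L S m"
proof
  fix p assume "p \<in> green_L S m O green_R S m"
  then obtain a b c where p: "p = (a, b)"
    and L: "(a, c) \<in> green_L S m" and R: "(c, b) \<in> green_R S m"
    by blast
  have S: "a \<in> S" "b \<in> S" "c \<in> S"
    using L R by (auto simp: green_L_def green_R_def)
  have refl: "(x, x) \<in> green_L S m" "(x, x) \<in> green_R S m" if "x \<in> S" for x
    using that by (auto simp: green_L_def green_R_def)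
  show "p \<in> green_R S m O green_L S m"
  proof (cases "a = c \<or> b = c")
    case True
    then show ?thesis using L R S refl p by blast
  next
    case False
    obtain t where t: "t \<in> S" "b = m c t"
      using R False unfolding green_R_iff right_ideal_def by blast
    obtain s where s: "s \<in> S" "a = m s c"
      using L False unfolding green_L_iff left_ideal_def by blast
    have "m s b = m a t"
      using s t S m_assoc by simp
    moreover have "(m a t, m c t) \<in> green_L S m"
      using green_L_right_mult L t by blast
    moreover have "(m s c, m s b) \<in> green_R S m"
      using green_R_left_mult R s by blast
    ultimately show ?thesis using s t p by auto
  qed
qed

lemma LR_eq_RL: "green_L S m O green_R S m = green_R S m O green_L S m"
proof
  have "(green_L S m O green_R S m)\<inverse> \<subseteq> (green_R S m O green_L S m)\<inverse>"
    using LR_subset_RL by blast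
  moreover have "(green_L S m)\<inverse> = green_L S m" "(green_R S m)\<inverse> = green_R S m"
    by (auto simp: green_L_def green_R_def)
  ultimately show "green_R S m O green_L S m \<subseteq> green_L S m O green_R S m"
    by (simp add: converse_relcomp)
qed (rule LR_subset_RL)

text \<open>The join of \<open>\<L>\<close> and \<open>\<R>\<close> among equivalence relations is the transitive closure of their union.\<close>

lemma green_D_eq_join: "green_D S m = (green_L S m \<union> green_R S m)\<^sup>+"
proof
  let ?L = "green_L S m" and ?R = "green_R S m"
  have sub: "?L \<union> ?R \<subseteq> green_D S m"
    unfolding green_D_def green_L_def green_R_def by blast
  have "?L O ?L \<subseteq> ?L" "?R O ?R \<subseteq> ?R"
    by (auto simp: green_L_def green_R_def)
  then have "trans (green_D S m)"
    using LR_eq_RL unfolding green_D_def trans_def by blast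
  then show "(?L \<union> ?R)\<^sup>+ \<subseteq> green_D S m"
    using sub by (metis trancl_id trancl_mono_subset)
  show "green_D S m \<subseteq> (?L \<union> ?R)\<^sup>+"
    unfolding green_D_def by (auto intro: trancl_trans)
qed

end


section \<open>The semigroup of endomorphisms with restricted range\<close>

definition T :: "'a set \<Rightarrow> 'a operation set \<Rightarrow> 'a set \<Rightarrow> ('a \<Rightarrow> 'a) set" where
  "T A F B = {\<alpha> \<in> endos A F. \<alpha> ` A \<subseteq> B}"

text \<open>Maps are written on the right, so the product \<open>\<alpha>\<beta>\<close> applies \<open>\<alpha>\<close> first.\<close>

definition rcomp :: "'a set \<Rightarrow> ('a \<Rightarrow> 'a) \<Rightarrow> ('a \<Rightarrow> 'a) \<Rightarrow> 'a \<Rightarrow> 'a" where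
  "rcomp A \<alpha> \<beta> = compose A \<beta> \<alpha>"

lemma semigroup_T:
  assumes "universal_algebra A F" "B \<subseteq> A"
  shows "semigroup_on (T A F B) (rcomp A)"
proof
  interpret universal_algebra A F by fact
  fix \<alpha> \<beta> assume \<alpha>: "\<alpha> \<in> T A F B" and \<beta>: "\<beta> \<in> T A F B"
  have map: "\<alpha> \<in> A \<rightarrow> A" "\<beta> \<in> A \<rightarrow> A"
    using \<alpha> \<beta> by (auto simp: T_def endos_def)
  have hom: "\<alpha> (f xs) = f (map \<alpha> xs)" "\<beta> (f xs) = f (map \<beta> xs)"
    if "(k, f) \<in> F" "length xs = k" "set xs \<subseteq> A" for k f xs
    using \<alpha> \<beta> that by (auto simp: T_def endos_def)
  have cl: "f xs \<in> A" if "(k, f) \<in> F" "length xs = k" "set xs \<subseteq> A" for k f xs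
    using closed that unfolding closed_under_def by blast
  have "rcomp A \<alpha> \<beta> (f xs) = f (map (rcomp A \<alpha> \<beta>) xs)"
    if "(k, f) \<in> F" "length xs = k" "set xs \<subseteq> A" for k f xs
  proof -
    have "set (map \<alpha> xs) \<subseteq> A" using that map by auto
    then have "\<beta> (\<alpha> (f xs)) = f (map \<beta> (map \<alpha> xs))"
      using that by (simp add: hom)
    moreover have "map \<beta> (map \<alpha> xs) = map (rcomp A \<alpha> \<beta>) xs"
      using that by (auto simp: rcomp_def compose_def)
    ultimately show ?thesis
      using cl[OF that] unfolding rcomp_def compose_def by (simp del: map_map)
  qed
  moreover have "rcomp A \<alpha> \<beta> ` A \<subseteq> B" "rcomp A \<alpha> \<beta> \<in> A \<rightarrow>\<^sub>E A"
    using \<beta> map by (auto simp: rcomp_def compose_def T_def)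
  ultimately show "rcomp A \<alpha> \<beta> \<in> T A F B"
    by (auto simp: T_def endos_def)
next
  fix \<alpha> \<beta> \<gamma> assume "\<alpha> \<in> T A F B"
  then have "\<alpha> \<in> A \<rightarrow> A" by (auto simp: T_def endos_def)
  then show "rcomp A (rcomp A \<alpha> \<beta>) \<gamma> = rcomp A \<alpha> (rcomp A \<beta> \<gamma>)"
    by (auto simp: rcomp_def compose_def fun_eq_iff)
qed

definition Q :: "'a set \<Rightarrow> 'a operation set \<Rightarrow> 'a set \<Rightarrow> ('a \<Rightarrow> 'a) set" where
  "Q A F B = {\<alpha> \<in> T A F B. \<alpha> ` A \<subseteq> \<alpha> ` B}"

definition ker :: "'a set \<Rightarrow> ('a \<Rightarrow> 'a) \<Rightarrow> 'a rel" where
  "ker A \<alpha> = {(x, y) \<in> A \<times> A. \<alpha> x = \<alpha> y}"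

definition rank :: "'a set \<Rightarrow> 'a operation set \<Rightarrow> ('a \<Rightarrow> 'a) \<Rightarrow> 'a rel" where
  "rank A F \<alpha> = adim F (\<alpha> ` A)"

end

(* By the free basis property every map into B from an independent set extends to T(A,B), which
   gives the two one-sided relations: \<alpha> \<R> \<beta> holds exactly when the kernels agree, because a map can
   be prescribed freely on a basis of A\<beta>; and distinct \<L>-related maps satisfy
   A\<alpha> \<subseteq> B\<beta> \<subseteq> A\<beta> \<subseteq> B\<alpha> \<subseteq> A\<alpha>, so they lie in Q and share their image, while conversely the values of
   \<alpha> on a basis of A can be lifted through \<beta> to B.  For \<D> = \<L> \<circ> \<R>, membership in Q and the rank
   depend only on the kernel, and a bijection between bases of A\<beta> and A\<alpha> turns \<beta> into a map with
   the kernel of \<beta> and the image of \<alpha>. *)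
theory Submission
  imports Defs
begin

section \<open>Term operations and generated subalgebras\<close>

lemma term_op_substitute:
  assumes "term_op F n t" "length is = n" "set is \<subseteq> {..<m}"
  shows "term_op F m (\<lambda>ys. t (map ((!) ys) is))"
  using assms
proof (induction rule: term_op.induct)
  case (proj i)
  then have "(\<lambda>ys. map ((!) ys) is ! i) = (\<lambda>ys::'a list. ys ! (is ! i))"
    by (simp add: fun_eq_iff)
  moreover have "is ! i < m"
    using proj by (metis lessThan_iff nth_mem subset_iff)
  ultimately show ?case
    by (simp add: term_op.proj)
next
  case (comp k f ts)
  have "term_op F m (\<lambda>ys. f (map (\<lambda>t. t ys) (map (\<lambda>t ys. t (map ((!) ys) is)) ts)))"
    using comp by (intro term_op.comp[where k = k]) auto
  then show ?case
    by (simp add: comp_def)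
qed

lemma term_op_closed:
  assumes "term_op F n t" "closed_under F S" "length xs = n" "set xs \<subseteq> S"
  shows "t xs \<in> S"
  using assms
proof (induction rule: term_op.induct)
  case (proj i)
  then show ?case by (metis nth_mem subset_iff)
next
  case (comp k f ts)
  then have "set (map (\<lambda>t. t xs) ts) \<subseteq> S" by auto
  then show ?case
    using comp unfolding closed_under_def by fastforce
qed

lemma gen_memI: "term_op F n t \<Longrightarrow> length xs = n \<Longrightarrow> set xs \<subseteq> X \<Longrightarrow> t xs \<in> gen F X"
  unfolding gen_def by blast

lemma gen_least: "X \<subseteq> S \<Longrightarrow> closed_under F S \<Longrightarrow> gen F X \<subseteq> S"
  unfolding gen_def using term_op_closed by blast

lemma gen_mono: "X \<subseteq> Y \<Longrightarrow> gen F X \<subseteq> gen F Y"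
  unfolding gen_def by blast

lemma gen_superset: "X \<subseteq> gen F X"
proof
  fix x assume "x \<in> X"
  moreover have "term_op F 1 (\<lambda>xs. xs ! 0)" by (rule term_op.proj) simp
  ultimately show "x \<in> gen F X"
    unfolding gen_def by (intro CollectI exI[of _ "\<lambda>xs. xs ! 0"] exI[of _ 1] exI[of _ "[x]"]) auto
qed

text \<open>A term operation reads a list, so the finite set of its entries already
  suffices.\<close>

lemma gen_finitary:
  assumes "x \<in> gen F X"
  obtains Y where "finite Y" "Y \<subseteq> X" "x \<in> gen F Y"
proof -
  obtain t n xs where "x = t xs" "term_op F n t" "length xs = n" "set xs \<subseteq> X"
    using assms unfolding gen_def by blast
  then show ?thesis
    by (intro that[of "set xs"]) (auto simp: gen_def)
qed

text \<open>The \<open>comp\<close> rule needs term operations of one arity, evaluated at one list,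
  whereas the elements of \<open>ys\<close> come with separate lists. Concatenating these and
  re-indexing each operation to read its own segment gives a common list; closure of
  \<open>gen F X\<close> rests on this.\<close>

lemma gen_common_list:
  assumes "set ys \<subseteq> gen F X"
  shows "\<exists>xs ts. set xs \<subseteq> X \<and> length ts = length ys \<and> (\<forall>t\<in>set ts. term_op F (length xs) t)
    \<and> ys = map (\<lambda>t. t xs) ts"
  using assms
proof (induction ys)
  case Nil
  show ?case by (rule exI[of _ "[]"], rule exI[of _ "[]"]) simp
next
  case (Cons y ys)
  then obtain xs ts where xs: "set xs \<subseteq> X" "length ts = length ys"
    "\<forall>t\<in>set ts. term_op F (length xs) t" "ys = map (\<lambda>t. t xs) ts"
    by auto
  obtain u zs where u: "y = u zs" "term_op F (length zs) u" "set zs \<subseteq> X"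
    using Cons.prems unfolding gen_def by auto
  let ?w = "zs @ xs"
  \<comment> \<open>In \<open>zs @ xs\<close> the operation for \<open>y\<close> reads the first
    \<open>length zs\<close> entries, and \<open>r\<close> shifts the earlier operations past
    them.\<close>
  define u' where "u' = (\<lambda>ys. u (map ((!) ys) [0..<length zs]))"
  define r where "r = (\<lambda>(t::'a list \<Rightarrow> 'a) ys. t (map ((!) ys) [length zs..<length ?w]))"
  have map1: "map ((!) ?w) [0..<length zs] = zs"
    by (rule nth_equalityI) (auto simp: nth_append)
  have map2: "map ((!) ?w) [length zs..<length ?w] = xs"
    by (rule nth_equalityI) (auto simp: nth_append)
  have "term_op F (length ?w) u'"
    unfolding u'_def by (rule term_op_substitute[OF u(2)]) auto
  moreover have "term_op F (length ?w) (r t)" if "t \<in> set ts" for t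
    unfolding r_def by (rule term_op_substitute[of F "length xs"]) (use xs that in auto)
  moreover have "y # ys = map (\<lambda>t. t ?w) (u' # map r ts)"
    using map1 map2 xs(4) u(1) by (simp add: u'_def r_def comp_def)
  ultimately show ?case
    using xs u(3) by (intro exI[of _ ?w] exI[of _ "u' # map r ts"]) auto
qed

lemma closed_under_gen: "closed_under F (gen F X)"
  unfolding closed_under_def
proof clarify
  fix f and ys :: "'a list"
  assume f: "(length ys, f) \<in> F" and "set ys \<subseteq> gen F X"
  then obtain xs ts where xs: "set xs \<subseteq> X" "length ts = length ys"
    "\<forall>t\<in>set ts. term_op F (length xs) t" "ys = map (\<lambda>t. t xs) ts"
    using gen_common_list by metis
  then have "term_op F (length xs) (\<lambda>xs. f (map (\<lambda>t. t xs) ts))"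
    using term_op.comp[OF f xs(2)] xs(3) by blast
  then have "f (map (\<lambda>t. t xs) ts) \<in> gen F X"
    using xs(1) by (rule gen_memI[OF _ refl])
  then show "f ys \<in> gen F X"
    by (subst xs(4))
qed

lemma gen_subset_iff: "gen F X \<subseteq> gen F Y \<longleftrightarrow> X \<subseteq> gen F Y"
  by (meson closed_under_gen gen_least gen_superset subset_trans)

lemma gen_closed: "closed_under F S \<Longrightarrow> gen F S = S"
  by (simp add: gen_least gen_superset subset_antisym)

text \<open>A dependence of \<open>x\<close> has a finite witness. Together with \<open>x\<close> it
  is a finite subset of the union of a chain, so it lies in a single member, which would then be
  dependent.\<close>

lemma independent_Union_chain:
  assumes "\<And>X. X \<in> C \<Longrightarrow> independent F X" "subset.chain S C"
  shows "independent F (\<Union>C)"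
  unfolding independent_def
proof (intro ballI notI)
  fix x assume x: "x \<in> \<Union>C" "x \<in> gen F (\<Union>C - {x})"
  then obtain Y where Y: "finite Y" "Y \<subseteq> \<Union>C - {x}" "x \<in> gen F Y"
    using gen_finitary by metis
  then have "finite (insert x Y)" "insert x Y \<subseteq> \<Union>C" "C \<noteq> {}"
    using x by auto
  then obtain X where X: "X \<in> C" "insert x Y \<subseteq> X"
    using finite_subset_Union_chain[OF _ _ _ assms(2)] by metis
  then have "x \<in> gen F (X - {x})"
    using Y gen_mono[of Y "X - {x}" F] by blast
  then show False
    using assms(1)[OF X(1)] X unfolding independent_def by blast
qed

section \<open>Endomorphisms and generated subalgebras\<close>

lemma endos_mapsto: "\<alpha> \<in> endos A F \<Longrightarrow> \<alpha> \<in> A \<rightarrow> A"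
  by (auto simp: endos_def)

context universal_algebra
begin

lemma gen_subset: "X \<subseteq> A \<Longrightarrow> gen F X \<subseteq> A"
  using gen_least closed by blast

lemma endo_term_op:
  assumes "\<alpha> \<in> endos A F" "term_op F n t" "length xs = n" "set xs \<subseteq> A"
  shows "\<alpha> (t xs) = t (map \<alpha> xs)"
  using assms(2-4)
proof (induction rule: term_op.induct)
  case (comp k f ts)
  \<comment> \<open>The homomorphism condition speaks only of arguments in \<open>A\<close>, so the
    values of the subterms must lie there.\<close>
  have "set (map (\<lambda>t. t xs) ts) \<subseteq> A"
    using comp term_op_closed[OF _ closed comp.prems] by auto
  then have "\<alpha> (f (map (\<lambda>t. t xs) ts)) = f (map \<alpha> (map (\<lambda>t. t xs) ts))"
    using assms(1) comp by (auto simp: endos_def)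
  also have "map \<alpha> (map (\<lambda>t. t xs) ts) = map (\<lambda>t. t (map \<alpha> xs)) ts"
    using comp by simp
  finally show ?case .
qed simp

lemma image_gen:
  assumes "\<alpha> \<in> endos A F" "X \<subseteq> A"
  shows "\<alpha> ` gen F X = gen F (\<alpha> ` X)"
proof
  show "\<alpha> ` gen F X \<subseteq> gen F (\<alpha> ` X)"
  proof clarify
    fix y assume "y \<in> gen F X"
    then obtain t xs where t: "y = t xs" "term_op F (length xs) t" "set xs \<subseteq> X"
      unfolding gen_def by auto
    then have "\<alpha> y = t (map \<alpha> xs)"
      using endo_term_op assms by blast
    moreover have "set (map \<alpha> xs) \<subseteq> \<alpha> ` X" "length (map \<alpha> xs) = length xs"
      using t by auto
    ultimately show "\<alpha> y \<in> gen F (\<alpha> ` X)"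
      using t(2) unfolding gen_def by blast
  qed
  show "gen F (\<alpha> ` X) \<subseteq> \<alpha> ` gen F X"
  proof
    fix y assume "y \<in> gen F (\<alpha> ` X)"
    then obtain t ys where t: "y = t ys" "term_op F (length ys) t" "set ys \<subseteq> \<alpha> ` X"
      unfolding gen_def by auto
    \<comment> \<open>Preimages in \<open>X\<close> are chosen for all entries of \<open>ys\<close>
      at once.\<close>
    then have "ys \<in> map \<alpha> ` lists X"
      by (metis in_listsI lists_image subsetD)
    then obtain xs where xs: "ys = map \<alpha> xs" "set xs \<subseteq> X"
      by auto
    then have "y = \<alpha> (t xs)"
      using t endo_term_op[OF assms(1), of "length xs" t xs] assms(2) by simp
    moreover have "t xs \<in> gen F X"
      using xs t unfolding gen_def by auto
    ultimately show "y \<in> \<alpha> ` gen F X" by blast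
  qed
qed

lemma endos_eq_on_gen:
  assumes "\<alpha> \<in> endos A F" "\<beta> \<in> endos A F" "X \<subseteq> A" "\<And>x. x \<in> X \<Longrightarrow> \<alpha> x = \<beta> x" "y \<in> gen F X"
  shows "\<alpha> y = \<beta> y"
proof -
  obtain t xs where t: "y = t xs" "term_op F (length xs) t" "set xs \<subseteq> X"
    using assms(5) unfolding gen_def by auto
  then have "map \<alpha> xs = map \<beta> xs"
    using assms(4) by auto
  then show ?thesis
    using endo_term_op[OF assms(1) t(2) refl] endo_term_op[OF assms(2) t(2) refl] t assms(3)
    by (metis subset_trans)
qed

lemma endos_restrict_id: "restrict id A \<in> endos A F"
proof -
  have "map (restrict id A) xs = xs" if "set xs \<subseteq> A" for xs
    using that by (intro map_idI) auto
  then show ?thesis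
    using closed unfolding endos_def closed_under_def by fastforce
qed

text \<open>Taking \<open>B = A\<close> turns facts about \<open>T A F B\<close>, such as closure
  under \<open>rcomp\<close> and factorisation, into facts about all endomorphisms.\<close>

lemma T_self: "T A F A = endos A F"
  by (auto simp: T_def endos_def)

lemma endos_rcomp:
  assumes "\<alpha> \<in> endos A F" "\<beta> \<in> endos A F"
  shows "rcomp A \<alpha> \<beta> \<in> endos A F"
  using semigroup_on.m_closed[OF semigroup_T[OF universal_algebra_axioms order_refl]] assms
  by (simp add: T_self)

lemma subalgebra_image: "\<alpha> \<in> endos A F \<Longrightarrow> subalgebra A F (\<alpha> ` A)"
  using image_gen[of \<alpha> A] gen_closed[OF closed] closed_under_gen[of F "\<alpha> ` A"] endos_mapsto[of \<alpha> A F]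
  by (auto simp: subalgebra_def)

text \<open>A dependence among the images under \<delta> is the image of an element of
  \<open>gen F (X - {x})\<close>, and the left inverse \<epsilon> pulls it back to a dependence in
  \<open>X\<close>.\<close>

lemma basis_image:
  assumes "basis F S X" "S \<subseteq> A" "\<delta> \<in> endos A F" "\<epsilon> \<in> endos A F"
    and inv: "\<And>x. x \<in> S \<Longrightarrow> \<epsilon> (\<delta> x) = x"
  shows "basis F (\<delta> ` S) (\<delta> ` X)"
proof -
  have X: "X \<subseteq> S" "independent F X" "gen F X = S"
    using assms(1) by (auto simp: basis_def)
  have inj: "inj_on \<delta> X"
    using X(1) inv by (metis inj_onI subsetD)
  have "\<delta> x \<notin> gen F (\<delta> ` X - {\<delta> x})" if x: "x \<in> X" for x
  proof
    assume "\<delta> x \<in> gen F (\<delta> ` X - {\<delta> x})"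
    moreover have "\<delta> ` X - {\<delta> x} = \<delta> ` (X - {x})"
      using inj x by (auto simp: inj_on_def)
    moreover have "gen F (\<delta> ` (X - {x})) = \<delta> ` gen F (X - {x})"
      using image_gen[OF assms(3), of "X - {x}"] X assms(2) by blast
    ultimately obtain y where y: "y \<in> gen F (X - {x})" "\<delta> x = \<delta> y"
      by auto
    moreover have "y \<in> S"
      using y X(3) gen_mono[of "X - {x}" X F] by blast
    ultimately have "x \<in> gen F (X - {x})"
      using inv x X(1) by (metis subsetD)
    then show False
      using X(2) x by (auto simp: independent_def)
  qed
  then show ?thesis
    using X image_gen[OF assms(3), of X] assms(2) by (auto simp: basis_def independent_def)
qed

end

section \<open>Bases and dimension\<close>

context independence_algebra
begin

text \<open>If adding \<open>a\<close> made some \<open>x\<close> in \<open>X\<close> dependent,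
  then exchange over \<open>X - {x}\<close> would put \<open>a\<close> into
  \<open>gen F X\<close>.\<close>

lemma independent_insert:
  assumes "independent F X" "X \<subseteq> A" "a \<in> A" "a \<notin> gen F X"
  shows "independent F (insert a X)"
  unfolding independent_def
proof (intro ballI notI)
  fix x assume x: "x \<in> insert a X" "x \<in> gen F (insert a X - {x})"
  have aX: "a \<notin> X"
    using assms(4) gen_superset[of X F] by blast
  show False
  proof (cases "x = a")
    case True
    then show False using x aX assms(4) by simp
  next
    case False
    then have xX: "x \<in> X" using x by simp
    have "insert a X - {x} = (X - {x}) \<union> {a}"
      using False by blast
    then have "x \<in> gen F ((X - {x}) \<union> {a})"
      using x(2) by metis
    moreover have "x \<notin> gen F (X - {x})"
      using assms(1) xX by (auto simp: independent_def)
    moreover have "X - {x} \<subseteq> A" "x \<in> A"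
      using assms(2) xX by auto
    ultimately have "a \<in> gen F ((X - {x}) \<union> {x})"
      using exchange assms(3) by metis
    moreover have "(X - {x}) \<union> {x} = X" using xX by blast
    ultimately show False
      using assms(4) by metis
  qed
qed

text \<open>Zorn's lemma yields a maximal independent set between \<open>X\<close> and
  \<open>S\<close>. It generates \<open>S\<close>, since any element of \<open>S\<close> outside its
  span could be added to it.\<close>

lemma extend_to_basis:
  assumes "independent F X" "X \<subseteq> S" "subalgebra A F S"
  obtains Y where "X \<subseteq> Y" "basis F S Y"
proof -
  let ?P = "{Y. X \<subseteq> Y \<and> Y \<subseteq> S \<and> independent F Y}"
  have "\<exists>M\<in>?P. \<forall>Z\<in>?P. M \<subseteq> Z \<longrightarrow> Z = M"
  proof (rule subset_Zorn_nonempty)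
    show "?P \<noteq> {}" using assms by auto
    fix C assume C: "C \<noteq> {}" "subset.chain ?P C"
    then have "C \<subseteq> ?P" by (auto simp: subset.chain_def)
    then show "\<Union>C \<in> ?P"
      using C independent_Union_chain[OF _ C(2), of F] by blast
  qed
  then obtain Y where "Y \<in> ?P" and M: "\<forall>Z\<in>?P. Y \<subseteq> Z \<longrightarrow> Z = Y"
    by (rule bexE)
  then have Y: "X \<subseteq> Y" "Y \<subseteq> S" "independent F Y"
    by simp_all
  have max: "Z = Y" if "X \<subseteq> Z" "Z \<subseteq> S" "independent F Z" "Y \<subseteq> Z" for Z
    using M that by simp
  have S: "S \<subseteq> A" "closed_under F S"
    using assms(3) by (auto simp: subalgebra_def)
  have "S \<subseteq> gen F Y"
  proof
    fix a assume a: "a \<in> S"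
    show "a \<in> gen F Y"
    proof (rule ccontr)
      assume "a \<notin> gen F Y"
      then have "insert a Y = Y"
        using max[of "insert a Y"] independent_insert[of Y a] Y S a by blast
      then show False
        using \<open>a \<notin> gen F Y\<close> gen_superset[of Y F] by blast
    qed
  qed
  then show ?thesis
    using that[of Y] Y gen_least[OF Y(2) S(2)] by (auto simp: basis_def)
qed

lemma basis_exists:
  assumes "subalgebra A F S"
  obtains Y where "basis F S Y"
  using extend_to_basis[of "{}" S] assms by (auto simp: independent_def)

text \<open>
  Steinitz exchange: in a smallest \<open>W \<supseteq> X \<inter> Y\<close> generating \<open>x\<close>, any \<open>y \<in> W - X\<close> can be traded for \<open>x\<close>.
\<close>

lemma card_independent_le:
  assumes "finite X" "finite Y" "independent F X" "X \<subseteq> gen F Y" "Y \<subseteq> A"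
  shows "card X \<le> card Y"
  using assms
\<comment> \<open>Each trade keeps \<open>card Y\<close> and the span condition, and moves one more
  element of \<open>X\<close> into \<open>Y\<close>.\<close>
proof (induction "card (X - Y)" arbitrary: Y)
  case 0
  then show ?case by (simp add: card_mono)
next
  case (Suc n)
  have "X - Y \<noteq> {}"
    using Suc.hyps(2) by (metis card.empty nat.distinct(1))
  then obtain x where x: "x \<in> X" "x \<notin> Y" by blast
  have xA: "x \<in> A"
    using x Suc.prems gen_subset by blast
  have nx: "x \<notin> gen F (X - {x})"
    using x Suc.prems by (auto simp: independent_def)
  have "\<exists>y Z. y \<in> Y - X \<and> Z \<subseteq> Y \<and> y \<notin> Z \<and> X \<inter> Y \<subseteq> Z \<and> x \<in> gen F (insert y Z) \<and> x \<notin> gen F Z"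
  proof -
    let ?P = "\<lambda>W. X \<inter> Y \<subseteq> W \<and> W \<subseteq> Y \<and> x \<in> gen F W"
    have P: "?P Y" using x Suc.prems by auto
    define W where "W = arg_min card ?P"
    have W: "?P W" and min: "\<And>V. ?P V \<Longrightarrow> card W \<le> card V"
      unfolding W_def using arg_min_natI[of ?P Y card, OF P] arg_min_nat_le[of ?P _ card] by auto
    \<comment> \<open>As \<open>x\<close> is not in \<open>Y\<close>, the intersection is contained
      in \<open>X - {x}\<close>, which does not generate \<open>x\<close>; so the minimal
      \<open>W\<close> has an element outside it.\<close>
    have "x \<notin> gen F (X \<inter> Y)"
      using nx gen_mono[of "X \<inter> Y" "X - {x}" F] x by blast
    then have "\<not> W \<subseteq> X \<inter> Y"
      using W gen_mono[of W "X \<inter> Y" F] by blast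
    then obtain y where y: "y \<in> W" "y \<notin> X \<inter> Y"
      by blast
    have "finite W" using W Suc.prems finite_subset by blast
    then have "card (W - {y}) < card W"
      using y(1) by (rule card_Diff1_less)
    then have "\<not> ?P (W - {y})"
      using min[of "W - {y}"] by (metis linorder_not_less)
    then have "x \<notin> gen F (W - {y})"
      using W y by blast
    then show ?thesis
      using W y by (intro exI[of _ y] exI[of _ "W - {y}"]) (auto simp: insert_absorb)
  qed
  then obtain y Z where y: "y \<in> Y" "y \<notin> X" and Z: "Z \<subseteq> Y" "y \<notin> Z"
    "x \<in> gen F (insert y Z)" "x \<notin> gen F Z"
    by blast
  let ?Y = "insert x (Y - {y})"
  \<comment> \<open>Exchange recovers \<open>y\<close> from the traded set \<open>?Y\<close>, which
    therefore generates all of \<open>Y\<close> and hence \<open>X\<close>.\<close>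
  have "y \<in> gen F (Z \<union> {x})"
  proof (rule exchange)
    show "Z \<subseteq> A" "y \<in> A" using Z(1) y(1) Suc.prems(5) by auto
    show "x \<in> gen F (Z \<union> {y})" using Z(3) by simp
  qed (use xA Z(4) in auto)
  moreover have "Z \<union> {x} \<subseteq> ?Y" using Z by auto
  ultimately have "y \<in> gen F ?Y"
    using gen_mono[of "Z \<union> {x}" ?Y F] by blast
  moreover have "Y \<subseteq> insert y ?Y" by blast
  ultimately have "Y \<subseteq> gen F ?Y"
    using gen_superset[of ?Y F] by blast
  then have "X \<subseteq> gen F ?Y"
    using Suc.prems(4) gen_subset_iff[of F Y ?Y] by blast
  moreover have "X - ?Y = (X - Y) - {x}"
    using y by auto
  then have "n = card (X - ?Y)"
    using Suc.hyps(2) x Suc.prems(1) by simp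
  moreover have "finite ?Y" "?Y \<subseteq> A"
    using Suc.prems(2,5) xA by auto
  ultimately have "card X \<le> card ?Y"
    using Suc.hyps(1) Suc.prems(1,3) by blast
  also have "card ?Y = card Y"
    using x(2) card.remove[OF Suc.prems(2) y(1)] Suc.prems(2) by simp
  finally show ?case .
qed

text \<open>Each \<open>y\<close> is generated by a finite part of \<open>X\<close>. The union of
  these parts generates \<open>S\<close>, and no proper subset of the independent set
  \<open>X\<close> does, so the parts exhaust \<open>X\<close>.\<close>

lemma basis_covered_by_supports:
  assumes "basis F S X" "basis F S Y"
  obtains Z where "\<And>y. y \<in> Y \<Longrightarrow> finite (Z y)" "X = (\<Union>y\<in>Y. Z y)"
proof -
  have "\<exists>Z. finite Z \<and> Z \<subseteq> X \<and> y \<in> gen F Z" if "y \<in> Y" for y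
    using that assms gen_finitary[of y F X] by (metis basis_def subsetD)
  then obtain Z where Z: "\<And>y. y \<in> Y \<Longrightarrow> finite (Z y) \<and> Z y \<subseteq> X \<and> y \<in> gen F (Z y)"
    by metis
  let ?U = "\<Union>y\<in>Y. Z y"
  have "Y \<subseteq> gen F ?U"
    using Z gen_mono[of _ ?U F] by blast
  then have gU: "S \<subseteq> gen F ?U"
    using assms(2) gen_subset_iff[of F Y ?U] by (simp add: basis_def)
  have "X \<subseteq> ?U"
  proof
    fix x assume x: "x \<in> X"
    show "x \<in> ?U"
    proof (rule ccontr)
      assume "x \<notin> ?U"
      then have "?U \<subseteq> X - {x}" using Z by blast
      then have "x \<in> gen F (X - {x})"
        using gU x assms(1) gen_mono[of ?U "X - {x}" F] by (auto simp: basis_def)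
      then show False
        using x assms(1) by (auto simp: basis_def independent_def)
    qed
  qed
  then show ?thesis using that[of Z] Z by blast
qed

text \<open>For finite \<open>Y\<close> the supports make \<open>X\<close> finite and Steinitz
  exchange applies; for infinite \<open>Y\<close>, a union of \<open>|Y|\<close> many finite sets
  has at most \<open>|Y|\<close> elements.\<close>

lemma basis_ordLeq:
  assumes "basis F S X" "basis F S Y" "S \<subseteq> A"
  shows "|X| \<le>o |Y|"
proof -
  obtain Z where Z: "\<And>y. y \<in> Y \<Longrightarrow> finite (Z y)" "X = (\<Union>y\<in>Y. Z y)"
    using basis_covered_by_supports[OF assms(1,2)] by metis
  show ?thesis
  proof (cases "finite Y")
    case True
    then have "finite X" using Z by auto
    then have "card X \<le> card Y"
      using True card_independent_le[of X Y] assms by (auto simp: basis_def)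
    then show ?thesis
      using inj_on_iff_card_le[OF \<open>finite X\<close> True] card_of_ordLeq by metis
  next
    case False
    have "|Z y| \<le>o |Y|" if "y \<in> Y" for y
    proof (rule ccontr)
      assume "\<not> |Z y| \<le>o |Y|"
      then have "|Y| \<le>o |Z y|"
        using ordLeq_total card_of_Well_order by blast
      then show False
        using card_of_ordLeq_finite Z(1)[OF that] False by blast
    qed
    then show ?thesis
      using card_of_UNION_ordLeq_infinite[OF False, of Y Z] Z(2) ordIso_iff_ordLeq card_of_refl[of Y]
      by auto
  qed
qed

text \<open>Any two bases bound each other, so the choice hidden in \<open>adim\<close> does not
  matter up to \<open>=o\<close>.\<close>

lemma adim_ordIso_basis:
  assumes "basis F S X" "S \<subseteq> A"
  shows "adim F S =o |X|"
  using someI[of "basis F S", OF assms(1)] basis_ordLeq assms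
  unfolding adim_def by (simp add: ordIso_iff_ordLeq)

lemma adim_image:
  assumes "subalgebra A F S" "\<delta> \<in> endos A F" "\<epsilon> \<in> endos A F"
    and inv: "\<And>x. x \<in> S \<Longrightarrow> \<epsilon> (\<delta> x) = x"
  shows "adim F S =o adim F (\<delta> ` S)"
proof -
  have S: "S \<subseteq> A" using assms(1) by (auto simp: subalgebra_def)
  obtain X where X: "basis F S X"
    using basis_exists assms(1) by blast
  have "inj_on \<delta> X"
    using X inv by (metis basis_def inj_onI subsetD)
  then have "|X| =o |\<delta> ` X|"
    using card_of_ordIso inj_on_imp_bij_betw by blast
  moreover have "\<delta> ` S \<subseteq> A"
    using S endos_mapsto[OF assms(2)] by blast
  ultimately show ?thesis
    using adim_ordIso_basis[OF X S] adim_ordIso_basis[OF basis_image[OF X S assms(2,3) inv]]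
    by (meson ordIso_symmetric ordIso_transitive)
qed

section \<open>Green's relations on endomorphisms with restricted range\<close>

text \<open>After extending \<open>X\<close> to a basis of \<open>A\<close>, freeness supplies an
  endomorphism. Its image is generated by the values on that basis, so it stays in \<open>B\<close>
  when these do.\<close>

lemma extend_to_T:
  assumes "independent F X" "X \<subseteq> A" "subalgebra A F B" "B \<noteq> {}" "g \<in> X \<rightarrow> B"
  obtains \<gamma> where "\<gamma> \<in> T A F B" "\<And>x. x \<in> X \<Longrightarrow> \<gamma> x = g x"
proof -
  obtain Y where Y: "X \<subseteq> Y" "basis F A Y"
    using extend_to_basis[OF assms(1,2)] closed by (auto simp: subalgebra_def)
  obtain b where b: "b \<in> B" using assms by blast
  \<comment> \<open>The added basis elements go to an arbitrary \<open>b\<close> in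
    \<open>B\<close>.\<close>
  let ?h = "\<lambda>y. if y \<in> X then g y else b"
  have B: "B \<subseteq> A" "closed_under F B"
    using assms(3) by (auto simp: subalgebra_def)
  have "?h \<in> Y \<rightarrow> A"
    using funcset_mem[OF assms(5)] subsetD[OF B(1)] b by simp
  then obtain \<gamma> where \<gamma>: "\<gamma> \<in> endos A F" "\<And>y. y \<in> Y \<Longrightarrow> \<gamma> y = ?h y"
    using free_basis[OF Y(2)] by blast
  have "\<gamma> ` Y \<subseteq> B" using \<gamma>(2) b assms(5) by auto
  then have "gen F (\<gamma> ` Y) \<subseteq> B"
    using gen_least B(2) by blast
  then have "\<gamma> ` A \<subseteq> B"
    using image_gen[OF \<gamma>(1), of Y] Y(2) by (auto simp: basis_def)
  then have "\<gamma> \<in> T A F B" using \<gamma>(1) by (simp add: T_def)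
  moreover have "\<gamma> x = g x" if "x \<in> X" for x
    using \<gamma>(2)[of x] Y(1) that by auto
  ultimately show ?thesis by (rule that)
qed

text \<open>The factor \<gamma> is prescribed on a basis of the image of \<beta>: lift a basis
  element through \<beta>, then apply \<alpha>.\<close>

lemma rcomp_factor_ker:
  assumes "subalgebra A F B" "B \<noteq> {}" "\<alpha> \<in> T A F B" "\<beta> \<in> T A F B" "ker A \<alpha> = ker A \<beta>"
  obtains \<gamma> where "\<gamma> \<in> T A F B" "\<alpha> = rcomp A \<beta> \<gamma>"
proof -
  have endo: "\<alpha> \<in> endos A F" "\<beta> \<in> endos A F"
    using assms by (auto simp: T_def)
  obtain X where X: "basis F (\<beta> ` A) X"
    using basis_exists subalgebra_image[OF endo(2)] by blast
  have XA: "X \<subseteq> A" "X \<subseteq> \<beta> ` A"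
    using X endos_mapsto[OF endo(2)] by (auto simp: basis_def)
  define c where "c = inv_into A \<beta>"
  have c: "c x \<in> A" "\<beta> (c x) = x" if "x \<in> X" for x
    using that XA unfolding c_def by (auto intro: inv_into_into f_inv_into_f)
  have "(\<lambda>x. \<alpha> (c x)) \<in> X \<rightarrow> B"
    using c assms(3) by (auto simp: T_def)
  then obtain \<gamma> where \<gamma>: "\<gamma> \<in> T A F B" "\<And>x. x \<in> X \<Longrightarrow> \<gamma> x = \<alpha> (c x)"
    using extend_to_T[of X B "\<lambda>x. \<alpha> (c x)"] X XA assms by (auto simp: basis_def)
  have \<gamma>endo: "\<gamma> \<in> endos A F" using \<gamma> by (auto simp: T_def)
  have eq: "\<gamma> (\<beta> a) = \<alpha> a" if a: "a \<in> A" for a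
  proof -
    \<comment> \<open>The lifts \<open>c x\<close> may generate less than \<open>A\<close>, but
      \<beta> maps their span onto its whole image. So each \<open>a\<close> has a companion
      \<open>d\<close> in that span with the same value under \<beta>, and equal kernels carry the
      identity from \<open>d\<close> to \<open>a\<close>.\<close>
    have cX: "c ` X \<subseteq> A" using c by auto
    have "\<beta> ` c ` X = X" using c by force
    then have "\<beta> ` gen F (c ` X) = \<beta> ` A"
      using image_gen[OF endo(2) cX] X by (simp add: basis_def)
    then obtain d where d: "d \<in> gen F (c ` X)" "\<beta> d = \<beta> a"
      using a by (metis imageE imageI)
    then have dA: "d \<in> A" using gen_subset[OF cX] by blast
    have "rcomp A \<beta> \<gamma> d = \<alpha> d"
    proof (rule endos_eq_on_gen[OF endos_rcomp[OF endo(2) \<gamma>endo] endo(1) cX _ d(1)])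
      show "rcomp A \<beta> \<gamma> y = \<alpha> y" if "y \<in> c ` X" for y
        using that c \<gamma>(2) by (auto simp: rcomp_def compose_def)
    qed
    moreover have "\<alpha> d = \<alpha> a"
      using assms(5) d(2) dA a unfolding ker_def by blast
    ultimately show ?thesis
      using d(2) dA by (simp add: rcomp_def compose_def)
  qed
  have "\<alpha> = rcomp A \<beta> \<gamma>"
    using endo(1) eq by (auto simp: endos_def rcomp_def compose_def fun_eq_iff)
  then show ?thesis using that \<gamma> by blast
qed

text \<open>On a basis of \<open>A\<close> the values of \<alpha> have \<beta>-preimages in
  \<open>B\<close>; these prescribe \<gamma>, and agreement spreads from the basis to
  \<open>A\<close>.\<close>

lemma rcomp_factor_image:
  assumes "subalgebra A F B" "B \<noteq> {}" "\<alpha> \<in> T A F B" "\<beta> \<in> T A F B" "\<alpha> ` A \<subseteq> \<beta> ` B"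
  obtains \<gamma> where "\<gamma> \<in> T A F B" "\<alpha> = rcomp A \<gamma> \<beta>"
proof -
  have endo: "\<alpha> \<in> endos A F" "\<beta> \<in> endos A F"
    using assms by (auto simp: T_def)
  have "subalgebra A F A" using closed by (auto simp: subalgebra_def)
  then obtain X where X: "basis F A X"
    using basis_exists by blast
  then have XA: "X \<subseteq> A" by (auto simp: basis_def)
  define g where "g = (\<lambda>x. inv_into B \<beta> (\<alpha> x))"
  have g: "g x \<in> B" "\<beta> (g x) = \<alpha> x" if "x \<in> X" for x
  proof -
    have "\<alpha> x \<in> \<beta> ` B" using that XA assms(5) by blast
    then show "g x \<in> B" "\<beta> (g x) = \<alpha> x"
      unfolding g_def by (auto intro: inv_into_into f_inv_into_f)
  qed
  then obtain \<gamma> where \<gamma>: "\<gamma> \<in> T A F B" "\<And>x. x \<in> X \<Longrightarrow> \<gamma> x = g x"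
    using extend_to_T[of X B g] X XA assms by (auto simp: basis_def)
  have \<gamma>endo: "\<gamma> \<in> endos A F" using \<gamma> by (auto simp: T_def)
  have eq: "rcomp A \<gamma> \<beta> a = \<alpha> a" if "a \<in> A" for a
  proof (rule endos_eq_on_gen[OF endos_rcomp[OF \<gamma>endo endo(2)] endo(1) XA])
    show "rcomp A \<gamma> \<beta> y = \<alpha> y" if "y \<in> X" for y
      using that g \<gamma>(2) XA by (auto simp: rcomp_def compose_def)
    show "a \<in> gen F X" using that X by (simp add: basis_def)
  qed
  \<comment> \<open>Off \<open>A\<close> both sides are \<open>undefined\<close>.\<close>
  have "rcomp A \<gamma> \<beta> a = \<alpha> a" for a
    using eq[of a] endo(1) by (cases "a \<in> A") (auto simp: endos_def rcomp_def compose_def)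
  then show ?thesis using that \<gamma> by (metis ext)
qed

lemma green_R_T_iff:
  assumes "subalgebra A F B" "B \<noteq> {}" "\<alpha> \<in> T A F B" "\<beta> \<in> T A F B"
  shows "(\<alpha>, \<beta>) \<in> green_R (T A F B) (rcomp A) \<longleftrightarrow> ker A \<alpha> = ker A \<beta>"
proof
  have B: "B \<subseteq> A" using assms(1) by (auto simp: subalgebra_def)
  interpret S: semigroup_on "T A F B" "rcomp A"
    using semigroup_T[OF universal_algebra_axioms B] .
  have sub: "ker A \<beta> \<subseteq> ker A \<alpha>" if "\<alpha> \<in> right_ideal (T A F B) (rcomp A) \<beta>" for \<alpha> \<beta>
    using that by (auto simp: right_ideal_def ker_def rcomp_def compose_def)
  show "ker A \<alpha> = ker A \<beta>" if "(\<alpha>, \<beta>) \<in> green_R (T A F B) (rcomp A)"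
    using that sub unfolding S.green_R_iff by blast
  assume "ker A \<alpha> = ker A \<beta>"
  then have "\<alpha> \<in> right_ideal (T A F B) (rcomp A) \<beta>" "\<beta> \<in> right_ideal (T A F B) (rcomp A) \<alpha>"
    using rcomp_factor_ker[OF assms, of "\<alpha> \<in> right_ideal (T A F B) (rcomp A) \<beta>"]
      rcomp_factor_ker[OF assms(1,2,4,3), of "\<beta> \<in> right_ideal (T A F B) (rcomp A) \<alpha>"]
    unfolding right_ideal_def by auto
  then show "(\<alpha>, \<beta>) \<in> green_R (T A F B) (rcomp A)"
    using assms S.green_R_iff by blast
qed

lemma green_L_T_iff:
  assumes "subalgebra A F B" "B \<noteq> {}" "\<alpha> \<in> T A F B" "\<beta> \<in> T A F B"
  shows "(\<alpha>, \<beta>) \<in> green_L (T A F B) (rcomp A) \<longleftrightarrow>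
    \<alpha> = \<beta> \<or> (\<alpha> ` A = \<beta> ` A \<and> \<alpha> \<in> Q A F B \<and> \<beta> \<in> Q A F B)"
proof
  have B: "B \<subseteq> A" using assms(1) by (auto simp: subalgebra_def)
  interpret S: semigroup_on "T A F B" "rcomp A"
    using semigroup_T[OF universal_algebra_axioms B] .
  \<comment> \<open>The alternative \<alpha> = \<beta> is the adjoined identity; a genuine left
    factor has image in \<open>B\<close>, so \<beta> is applied only to elements of
    \<open>B\<close>.\<close>
  have sub: "\<alpha> = \<beta> \<or> \<alpha> ` A \<subseteq> \<beta> ` B" if "\<alpha> \<in> left_ideal (T A F B) (rcomp A) \<beta>" for \<alpha> \<beta>
    using that by (auto simp: left_ideal_def T_def rcomp_def compose_def)
  show "\<alpha> = \<beta> \<or> (\<alpha> ` A = \<beta> ` A \<and> \<alpha> \<in> Q A F B \<and> \<beta> \<in> Q A F B)"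
    if le: "(\<alpha>, \<beta>) \<in> green_L (T A F B) (rcomp A)"
  proof -
    consider "\<alpha> = \<beta>" | "\<alpha> ` A \<subseteq> \<beta> ` B" "\<beta> ` A \<subseteq> \<alpha> ` B"
      using le sub[of \<alpha> \<beta>] sub[of \<beta> \<alpha>] unfolding S.green_L_iff by blast
    then show ?thesis
    proof cases
      case 2
      have "\<beta> ` B \<subseteq> \<beta> ` A" "\<alpha> ` B \<subseteq> \<alpha> ` A"
        using B by (simp_all add: image_mono)
      then have "\<alpha> ` A = \<beta> ` A" "\<alpha> ` A \<subseteq> \<alpha> ` B" "\<beta> ` A \<subseteq> \<beta> ` B"
        using 2 by (meson subset_antisym subset_trans)+
      then show ?thesis using assms(3,4) by (simp add: Q_def)
    qed simp
  qed
  assume rhs: "\<alpha> = \<beta> \<or> (\<alpha> ` A = \<beta> ` A \<and> \<alpha> \<in> Q A F B \<and> \<beta> \<in> Q A F B)"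
  show "(\<alpha>, \<beta>) \<in> green_L (T A F B) (rcomp A)"
  proof (cases "\<alpha> = \<beta>")
    case True
    then show ?thesis using assms by (auto simp: green_L_def)
  next
    case False
    then have eq: "\<alpha> ` A = \<beta> ` A" and Q: "\<alpha> \<in> Q A F B" "\<beta> \<in> Q A F B"
      using rhs by simp_all
    have "\<alpha> ` A \<subseteq> \<alpha> ` B" "\<beta> ` A \<subseteq> \<beta> ` B"
      using Q by (simp_all add: Q_def)
    then have img: "\<alpha> ` A \<subseteq> \<beta> ` B" "\<beta> ` A \<subseteq> \<alpha> ` B"
      using eq by simp_all
    obtain \<gamma> where "\<gamma> \<in> T A F B" "\<alpha> = rcomp A \<gamma> \<beta>"
      by (rule rcomp_factor_image[OF assms img(1)])
    then have "\<alpha> \<in> left_ideal (T A F B) (rcomp A) \<beta>"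
      unfolding left_ideal_def by blast
    moreover obtain \<delta> where "\<delta> \<in> T A F B" "\<beta> = rcomp A \<delta> \<alpha>"
      by (rule rcomp_factor_image[OF assms(1,2,4,3) img(2)])
    then have "\<beta> \<in> left_ideal (T A F B) (rcomp A) \<alpha>"
      unfolding left_ideal_def by blast
    ultimately show ?thesis
      using assms(3,4) by (simp add: S.green_L_iff)
  qed
qed

text \<open>With equal kernels each map is the other followed by an endomorphism of the whole
  algebra. These two endomorphisms are mutually inverse between the images, so they preserve
  dimension.\<close>

lemma rank_ker_cong:
  assumes "\<alpha> \<in> endos A F" "\<beta> \<in> endos A F" "ker A \<alpha> = ker A \<beta>"
  shows "rank A F \<alpha> =o rank A F \<beta>"
proof -
  have A: "subalgebra A F A" using closed by (simp add: subalgebra_def)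
  have T: "\<alpha> \<in> T A F A" "\<beta> \<in> T A F A" using assms T_self by auto
  obtain \<delta> where \<delta>: "\<delta> \<in> T A F A" "\<beta> = rcomp A \<alpha> \<delta>"
    using rcomp_factor_ker[OF A nonempty T(2,1)] assms(3) by metis
  obtain \<epsilon> where \<epsilon>: "\<epsilon> \<in> T A F A" "\<alpha> = rcomp A \<beta> \<epsilon>"
    using rcomp_factor_ker[OF A nonempty T] assms(3) by metis
  have app: "\<beta> a = \<delta> (\<alpha> a)" "\<alpha> a = \<epsilon> (\<beta> a)" if "a \<in> A" for a
    using that fun_cong[OF \<delta>(2), of a] fun_cong[OF \<epsilon>(2), of a] by (simp_all add: rcomp_def compose_def)
  have "adim F (\<alpha> ` A) =o adim F (\<delta> ` \<alpha> ` A)"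
  proof (rule adim_image[OF subalgebra_image[OF assms(1)]])
    show "\<delta> \<in> endos A F" "\<epsilon> \<in> endos A F" using \<delta> \<epsilon> T_self by auto
    show "\<epsilon> (\<delta> x) = x" if "x \<in> \<alpha> ` A" for x
      using that by (metis app imageE)
  qed
  moreover have "\<delta> ` \<alpha> ` A = \<beta> ` A"
    using app(1) by force
  ultimately show ?thesis by (simp add: rank_def)
qed

text \<open>Membership in \<open>Q\<close> says that every kernel class meets \<open>B\<close>,
  which is a property of the kernel alone.\<close>

lemma Q_ker_cong:
  assumes "\<alpha> \<in> Q A F B" "\<beta> \<in> T A F B" "B \<subseteq> A" "ker A \<alpha> = ker A \<beta>"
  shows "\<beta> \<in> Q A F B"
proof -
  have "\<beta> a \<in> \<beta> ` B" if a: "a \<in> A" for a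
  proof -
    obtain b where b: "b \<in> B" "\<alpha> a = \<alpha> b"
      using a assms(1) unfolding Q_def by blast
    then have "(a, b) \<in> ker A \<beta>"
      using a assms(3,4) unfolding ker_def by blast
    then show ?thesis using b unfolding ker_def by auto
  qed
  then show ?thesis using assms(2) by (auto simp: Q_def)
qed

text \<open>Equal ranks give a bijection between bases of the two images. Its extension \<theta>
  maps the image of \<beta> isomorphically onto that of \<alpha>, and \<gamma> is \<beta> followed
  by \<theta>.\<close>

lemma equal_rank_transport:
  assumes "\<alpha> \<in> endos A F" "\<beta> \<in> endos A F" "rank A F \<alpha> =o rank A F \<beta>"
  obtains \<gamma> where "\<gamma> \<in> endos A F" "\<gamma> ` A = \<alpha> ` A" "ker A \<gamma> = ker A \<beta>"
proof -
  have A: "subalgebra A F A" using closed by (simp add: subalgebra_def)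
  have img: "\<alpha> ` A \<subseteq> A" "\<beta> ` A \<subseteq> A"
    using endos_mapsto[OF assms(1)] endos_mapsto[OF assms(2)] by auto
  obtain X where X: "basis F (\<beta> ` A) X"
    using basis_exists subalgebra_image[OF assms(2)] by blast
  obtain Y where Y: "basis F (\<alpha> ` A) Y"
    using basis_exists subalgebra_image[OF assms(1)] by blast
  have XA: "X \<subseteq> A" and YA: "Y \<subseteq> A"
    using X Y img by (auto simp: basis_def)
  have "|X| =o |Y|"
    using adim_ordIso_basis[OF X img(2)] adim_ordIso_basis[OF Y img(1)] assms(3)
    unfolding rank_def by (meson ordIso_symmetric ordIso_transitive)
  then obtain h where h: "bij_betw h X Y"
    using card_of_ordIso by blast
  have "h \<in> X \<rightarrow> A"
    using h YA by (auto simp: bij_betw_def)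
  then obtain \<theta> where \<theta>: "\<theta> \<in> T A F A" "\<And>x. x \<in> X \<Longrightarrow> \<theta> x = h x"
    using extend_to_T[OF _ XA A nonempty] X unfolding basis_def by metis
  have "inv_into X h \<in> Y \<rightarrow> A"
    using bij_betw_inv_into[OF h] XA by (auto simp: bij_betw_def)
  then obtain \<eta> where \<eta>: "\<eta> \<in> T A F A" "\<And>y. y \<in> Y \<Longrightarrow> \<eta> y = inv_into X h y"
    using extend_to_T[OF _ YA A nonempty] Y unfolding basis_def by metis
  have endo: "\<theta> \<in> endos A F" "\<eta> \<in> endos A F"
    using \<theta> \<eta> T_self by auto
  \<comment> \<open>Following \<theta> by \<eta> fixes the basis \<open>X\<close>, hence its span;
    injectivity of \<theta> there keeps the kernel of \<beta>.\<close>
  have inv: "\<eta> (\<theta> z) = z" if z: "z \<in> \<beta> ` A" for z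
  proof -
    have "rcomp A \<theta> \<eta> z = restrict id A z"
    proof (rule endos_eq_on_gen[OF endos_rcomp[OF endo] endos_restrict_id XA])
      show "rcomp A \<theta> \<eta> x = restrict id A x" if "x \<in> X" for x
        using that \<theta>(2) \<eta>(2) h XA by (auto simp: rcomp_def compose_def bij_betw_def)
      show "z \<in> gen F X" using z X by (simp add: basis_def)
    qed
    then show ?thesis
      using z img(2) by (auto simp: rcomp_def compose_def)
  qed
  have "\<theta> ` X = Y"
    using h \<theta>(2) by (auto simp: bij_betw_def)
  then have img\<theta>: "\<theta> ` \<beta> ` A = \<alpha> ` A"
    using image_gen[OF endo(1) XA] X Y by (simp add: basis_def)
  show ?thesis
  proof
    show "rcomp A \<beta> \<theta> \<in> endos A F"
      using endos_rcomp assms(2) endo(1) by blast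
    show "rcomp A \<beta> \<theta> ` A = \<alpha> ` A"
      using img\<theta> by (simp add: rcomp_def compose_def image_image)
    have "\<theta> (\<beta> x) = \<theta> (\<beta> y) \<longleftrightarrow> \<beta> x = \<beta> y" if "x \<in> A" "y \<in> A" for x y
      using that inv by (metis imageI)
    then show "ker A (rcomp A \<beta> \<theta>) = ker A \<beta>"
      by (auto simp: ker_def rcomp_def compose_def)
  qed
qed

end

theorem proposition4p3:
  fixes A B :: "'a set" and F :: "'a operation set" and \<alpha> \<beta> :: "'a \<Rightarrow> 'a"
  assumes "independence_algebra A F"
    and "subalgebra A F B" and "B \<noteq> {}" and "B \<noteq> A"
    and "ctwo \<le>o adim F B \<or> (gen F {} \<noteq> {} \<and> adim F B =o cone)"
    and "\<alpha> \<in> T A F B" and "\<beta> \<in> T A F B"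
  shows "(\<alpha>, \<beta>) \<in> green_D (T A F B) (rcomp A) \<longleftrightarrow>
    ker A \<alpha> = ker A \<beta> \<or> (rank A F \<alpha> =o rank A F \<beta> \<and> \<alpha> \<in> Q A F B \<and> \<beta> \<in> Q A F B)"
proof -
  interpret independence_algebra A F by fact
  note B = assms(2,3)
  have BA: "B \<subseteq> A" using B(1) by (simp add: subalgebra_def)
  have endo: "\<alpha> \<in> endos A F" "\<beta> \<in> endos A F"
    using assms(6,7) by (auto simp: T_def)
  note L = green_L_T_iff[OF B] and R = green_R_T_iff[OF B]
  show ?thesis
  proof
    assume "(\<alpha>, \<beta>) \<in> green_D (T A F B) (rcomp A)"
    then obtain \<gamma> where LR: "(\<alpha>, \<gamma>) \<in> green_L (T A F B) (rcomp A)"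
      "(\<gamma>, \<beta>) \<in> green_R (T A F B) (rcomp A)"
      by (auto simp: green_D_def)
    then have \<gamma>: "\<gamma> \<in> T A F B" by (auto simp: green_R_def)
    then have ker: "ker A \<gamma> = ker A \<beta>"
      using LR(2) R assms(7) by blast
    consider "\<alpha> = \<gamma>" | "\<alpha> ` A = \<gamma> ` A" "\<alpha> \<in> Q A F B" "\<gamma> \<in> Q A F B"
      using LR(1) L[OF assms(6) \<gamma>] by blast
    then show "ker A \<alpha> = ker A \<beta> \<or> (rank A F \<alpha> =o rank A F \<beta> \<and> \<alpha> \<in> Q A F B \<and> \<beta> \<in> Q A F B)"
    proof cases
      case 1
      then show ?thesis using ker by simp
    next
      case 2
      \<comment> \<open>Equal images make the rank of \<gamma> that of \<alpha>, while equal kernels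
        pass both rank and membership in \<open>Q\<close> from \<gamma> to \<beta>.\<close>
      have "rank A F \<gamma> =o rank A F \<beta>"
        using rank_ker_cong[OF _ endo(2) ker] \<gamma> by (auto simp: T_def)
      then show ?thesis
        using 2 Q_ker_cong[OF 2(3) assms(7) BA ker] by (simp add: rank_def)
    qed
  next
    assume "ker A \<alpha> = ker A \<beta> \<or> (rank A F \<alpha> =o rank A F \<beta> \<and> \<alpha> \<in> Q A F B \<and> \<beta> \<in> Q A F B)"
    then consider "ker A \<alpha> = ker A \<beta>"
      | "rank A F \<alpha> =o rank A F \<beta>" "\<alpha> \<in> Q A F B" "\<beta> \<in> Q A F B"
      by blast
    then show "(\<alpha>, \<beta>) \<in> green_D (T A F B) (rcomp A)"
    proof cases
      case 1
      \<comment> \<open>Here \<alpha> itself is the intermediate element, by reflexivity of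
        \<open>green_L\<close>.\<close>
      then show ?thesis
        using R[OF assms(6,7)] L[OF assms(6,6)] by (auto simp: green_D_def)
    next
      case 2
      \<comment> \<open>The intermediate element has the image of \<alpha>, which puts it in
        \<open>T A F B\<close>, and the kernel of \<beta>, which puts it in \<open>Q A F B\<close>;
        so it is L-related to \<alpha> and R-related to \<beta>.\<close>
      obtain \<gamma> where \<gamma>: "\<gamma> \<in> endos A F" "\<gamma> ` A = \<alpha> ` A" "ker A \<gamma> = ker A \<beta>"
        using equal_rank_transport[OF endo 2(1)] by metis
      then have \<gamma>T: "\<gamma> \<in> T A F B"
        using assms(6) by (auto simp: T_def)
      then have "\<gamma> \<in> Q A F B"
        using Q_ker_cong[OF 2(3) _ BA] \<gamma>(3) by simp
      then show ?thesis
        using L[OF assms(6) \<gamma>T] R[OF \<gamma>T assms(7)] \<gamma> 2(2) by (auto simp: green_D_def)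
    qed
  qed
qed

end
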